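(* Let $0<|q|<1$. With $S(0,2;q,N)$ the polynomial in $q$ defined in the context, the following limits hold (with $M$ running over the non-negative integers): $$\lim_{M\to\infty}S(0,2;q^{-1},3M+1)\,q^{(M+1)(3M+2)}=\sum_{a,b\ge 0}\frac{q^{a^2-3ab+3b^2-2a+4b+1}}{(q^3;q^3)_b}\begin{bmatrix}3b-a+1\\ a\end{bmatrix}_q,$$ $$\lim_{M\to\infty}S(0,2;q^{-1},3M)\,q^{M(3M+2)}=\sum_{a,b\ge 0}\frac{q^{a^2-3ab+3b^2-2a+4b+1}}{(q^3;q^3)_b}\begin{bmatrix}3b-a+2\\ a\end{bmatrix}_q,$$ $$\lim_{M\to\infty}S(0,2;q^{-1},3M+2)\,q^{(M+1)(3M+2)}=\sum_{a,b\ge 0}\frac{q^{a^2-3ab+3b^2-2a+4b+1}}{(q^3;q^3)_b}\begin{bmatrix}3b-a+3\\ a\end{bmatrix}_q.$$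
   Context: Here $q$ is a nonzero complex number with $|q|<1$, and $(x;q)_n=\prod_{i=0}^{n-1}(1-q^ix)$. For $k,l\in\mathbb{Z}$ the Gaussian binomial coefficient is $\begin{bmatrix}k\\ l\end{bmatrix}_q=\frac{(q;q)_k}{(q;q)_l(q;q)_{k-l}}$ if $k\ge l\ge 0$, and $0$ if $l<0$ or $k<l$ (in particular $\begin{bmatrix}-1\\ 0\end{bmatrix}_q=0$); the subscript $q^3$ means that $q$ is replaced by $q^3$. For an integer $N\ge 0$, $$S(0,2;q,N)=\sum_{m,n\ge 0}q^{m^2+3mn+3n^2+2n}\begin{bmatrix}N+1-m-3n\\ m\end{bmatrix}_q\begin{bmatrix}\lfloor\frac23(N-1)\rfloor+1-m-n\\ n\end{bmatrix}_{q^3},$$ a polynomial in $q$, and $S(0,2;q^{-1},N)$ is the result of substituting $q^{-1}$ for $q$ in it. *)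

theory Defs
  imports "HOL-Analysis.Analysis"
begin

definition qpoch :: "complex \<Rightarrow> complex \<Rightarrow> nat \<Rightarrow> complex" where
  "qpoch x q n = (\<Prod>i<n. 1 - q ^ i * x)"

text \<open>The quotient of q-factorials agrees with the Gaussian polynomial at every \<open>q\<close> that is not a
  root of unity; at roots of unity a denominator may vanish, and the value is then meaningless.\<close>

definition qbinom :: "complex \<Rightarrow> int \<Rightarrow> int \<Rightarrow> complex" where
  "qbinom q k l =
     (if 0 \<le> l \<and> l \<le> k
      then qpoch q q (nat k) / (qpoch q q (nat l) * qpoch q q (nat (k - l)))
      else 0)"

text \<open>The value at \<open>q\<close> (not a root of unity) of the polynomial \<open>S(0,2;q,N)\<close>. The sum has finite
  support: the first Gaussian binomial vanishes unless \<open>2 * m + 3 * n \<le> N + 1\<close>.\<close>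

definition S02 :: "complex \<Rightarrow> nat \<Rightarrow> complex" where
  "S02 q N =
     (\<Sum>\<^sub>\<infinity>(m, n) \<in> (UNIV :: (nat \<times> nat) set).
        q ^ (m\<^sup>2 + 3 * m * n + 3 * n\<^sup>2 + 2 * n)
        * qbinom q (int N + 1 - int m - 3 * int n) (int m)
        * qbinom (q ^ 3) (\<lfloor>2 / 3 * (real N - 1)\<rfloor> + 1 - int m - int n) (int n))"

text \<open>The summand of the limiting series; the three limits have \<open>c = 1, 2, 3\<close>.
  The exponent is an integer expression, hence \<open>powi\<close>.\<close>

definition limit_term :: "complex \<Rightarrow> int \<Rightarrow> nat \<times> nat \<Rightarrow> complex" where
  "limit_term q c = (\<lambda>(a, b).
     q powi ((int a)\<^sup>2 - 3 * int a * int b + 3 * (int b)\<^sup>2 - 2 * int a + 4 * int b + 1)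
     / qpoch (q ^ 3) (q ^ 3) b
     * qbinom q (3 * int b - int a + c) (int a))"

end

theory Submission
  imports Defs
begin

text \<open>
  Replacing \<open>q\<close> by its inverse turns a Gaussian binomial with lower index \<open>l\<close> and complementary
  index \<open>j\<close> into itself divided by \<open>q ^ (l * j)\<close> (lemma \<open>qbinom_inverse\<close>). In the sum
  defining \<open>S(0,2;q\<^sup>-\<^sup>1,N)\<close>, change the summation indices from the lower indices \<open>m\<close>, \<open>n\<close> of the
  two binomials to their complementary indices, that is, to \<open>a = N + 1 - 2 m - 3 n\<close> and
  \<open>b = K - m - 2 n\<close>, where \<open>K = \<lfloor>2 (N - 1) / 3\<rfloor> + 1\<close>. Choose integers \<open>c\<close> and \<open>d\<close> with
  \<open>N + 1 = 2 c + 3 d\<close> and \<open>K = c + 2 d\<close>; then the substitution reads \<open>m = 3 b - 2 a + c\<close>,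
  \<open>n = d + a - 2 b\<close>, the upper index of the first binomial becomes \<open>3 b - a + c\<close>, and that of the
  second becomes \<open>d + a - b\<close>. The power of \<open>q\<close> splits into \<open>q powi (a\<^sup>2 - 3 a b + 3 b\<^sup>2 - 2 a + 4 b + 1)\<close>,
  which does not involve \<open>N\<close>, and the inverse of \<open>q powi (c\<^sup>2 + 3 c d + 3 d\<^sup>2 + 2 d + 1)\<close>, which is
  exactly the normalising factor (lemma \<open>S02_inverse_complementary\<close>). The three residue classes
  \<open>N = 3 M + 1\<close>, \<open>3 M\<close>, \<open>3 M + 2\<close> correspond to \<open>(c, d) = (1, M)\<close>, \<open>(2, M - 1)\<close>, \<open>(3, M - 1)\<close>.

  As \<open>d\<close> tends to infinity, only the second binomial changes, and it tends to
  \<open>1 / (q\<^sup>3;q\<^sup>3)\<^sub>b\<close> (lemma \<open>qbinom_tendsto\<close>). Limit and sum may be interchanged by dominated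
  convergence: Gaussian binomials are bounded uniformly in both indices (lemma \<open>qbinom_bounded\<close>),
  and the exponent, a positive definite quadratic polynomial in \<open>a\<close> and \<open>b\<close>, is at least
  \<open>a + b - 2\<close> (lemma \<open>limit_exponent_ge\<close>), so that a geometric double series dominates.
\<close>

section \<open>Gaussian binomials\<close>

lemma power_neq_1_of_norm_less_1:
  fixes q :: complex
  assumes "norm q < 1"
  shows "q ^ i * q \<noteq> 1"
proof
  assume "q ^ i * q = 1"
  then have "norm q ^ Suc i = 1"
    by (metis norm_one norm_power power_Suc2)
  with assms show False
    by (metis less_irrefl norm_ge_zero power_Suc_less_one power_0_Suc order_le_less zero_neq_one)
qed

lemma qpoch_self_nonzero: "norm q < 1 \<Longrightarrow> qpoch q q n \<noteq> 0"
  using power_neq_1_of_norm_less_1[of q] by (auto simp: qpoch_def)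

lemma qpoch_self_inverse:
  assumes "q \<noteq> 0"
  shows "qpoch (inverse q) (inverse q) n * q ^ (\<Sum>i<n. Suc i) = (- 1) ^ n * qpoch q q n"
proof (induction n)
  case 0
  show ?case by (simp add: qpoch_def)
next
  case (Suc n)
  have step: "(1 - inverse q ^ n * inverse q) * q ^ Suc n = - (1 - q ^ n * q)"
    using assms by (simp add: field_simps)
  have "qpoch (inverse q) (inverse q) (Suc n) * q ^ (\<Sum>i<Suc n. Suc i)
      = (qpoch (inverse q) (inverse q) n * q ^ (\<Sum>i<n. Suc i)) *
        ((1 - inverse q ^ n * inverse q) * q ^ Suc n)"
    by (simp only: qpoch_def prod.lessThan_Suc sum.lessThan_Suc power_add mult_ac)
  also have "\<dots> = (- 1) ^ Suc n * qpoch q q (Suc n)"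
    unfolding Suc.IH step by (simp add: qpoch_def algebra_simps)
  finally show ?case .
qed

lemma qbinom_eq_0: "k < l \<Longrightarrow> qbinom q k l = 0"
  by (simp add: qbinom_def)

lemma qbinom_add:
  "qbinom q (int l + int j) (int l) = qpoch q q (l + j) / (qpoch q q l * qpoch q q j)"
  by (simp add: qbinom_def nat_add_distrib)

lemma qbinom_add_commute:
  "qbinom q (int l + int j) (int l) = qbinom q (int l + int j) (int j)"
  using qbinom_add[of q l j] qbinom_add[of q j l] by (simp add: add.commute mult.commute)

text \<open>The Gaussian polynomial with parameters \<open>l + j\<close> and \<open>l\<close> is self-reciprocal of
  degree \<open>l * j\<close>.\<close>

lemma qbinom_inverse:
  assumes "q \<noteq> 0"
  shows "qbinom (inverse q) (int l + int j) (int l)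
       = qbinom q (int l + int j) (int l) / q ^ (l * j)"
proof -
  have tri: "(\<Sum>i<l + j. Suc i) = (\<Sum>i<l. Suc i) + (\<Sum>i<j. Suc i) + l * j"
    by (induction j) auto
  have inv: "qpoch (inverse q) (inverse q) n = (- 1) ^ n * qpoch q q n / q ^ (\<Sum>i<n. Suc i)" for n
    using qpoch_self_inverse[OF assms, of n] assms by (simp add: field_simps)
  have cancel: "(s * t * x / (A * B * C)) / ((s * y / A) * (t * z / B)) = x / (y * z) / C"
    if "s \<noteq> 0" "t \<noteq> 0" "A \<noteq> 0" "B \<noteq> 0" for s t x y z A B C :: complex
    using that by simp
  show ?thesis
    unfolding qbinom_add inv tri power_add
    by (rule cancel) (use assms in auto)
qed

text \<open>That the limit is nonzero makes quotients of these products bounded and lets their limits be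
  computed.\<close>

lemma qpoch_self_converges:
  assumes "norm q < 1"
  obtains P where "P \<noteq> 0" and "(\<lambda>n. qpoch q q n) \<longlonglongrightarrow> P"
proof -
  have "summable (\<lambda>i. norm (1 - q ^ i * q - 1))"
    using assms by (auto simp: norm_mult norm_power intro!: summable_mult2 summable_geometric)
  then have "convergent_prod (\<lambda>i. 1 - q ^ i * q)"
    by (intro abs_convergent_prod_imp_convergent_prod summable_imp_abs_convergent_prod)
  moreover have "1 - q ^ i * q \<noteq> 0" for i
    using power_neq_1_of_norm_less_1[OF assms, of i] by simp
  ultimately obtain P where "P \<noteq> 0" "(\<lambda>n. \<Prod>i\<le>n. 1 - q ^ i * q) \<longlonglongrightarrow> P"
    using convergent_prod_iff_nz_lim[of "\<lambda>i. 1 - q ^ i * q"] by auto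
  then show thesis
    by (intro that[of P]) (simp_all add: qpoch_def LIMSEQ_lessThan_iff_atMost)
qed

lemma qbinom_bounded:
  assumes "norm q < 1"
  obtains B where "\<And>k l. norm (qbinom q k l) \<le> B"
proof -
  obtain P where P: "P \<noteq> 0" "(\<lambda>n. qpoch q q n) \<longlonglongrightarrow> P"
    using qpoch_self_converges[OF assms] .
  obtain U where U: "\<And>n. norm (qpoch q q n) \<le> U"
    using convergent_imp_Bseq[OF convergentI[OF P(2)]] by (auto elim!: BseqE)
  obtain V where V: "\<And>n. norm (inverse (qpoch q q n)) \<le> V"
    using convergent_imp_Bseq[OF convergentI[OF tendsto_inverse[OF P(2) P(1)]]]
    by (auto elim!: BseqE)
  have "0 \<le> U" "0 \<le> V"
    using U[of 0] V[of 0] norm_ge_zero order_trans by blast+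
  have "norm (qbinom q k l) \<le> U * (V * V)" for k l
  proof (cases "0 \<le> l \<and> l \<le> k")
    case True
    then have "norm (qbinom q k l) = norm (qpoch q q (nat k)) *
        (norm (inverse (qpoch q q (nat l))) * norm (inverse (qpoch q q (nat (k - l)))))"
      by (simp add: qbinom_def norm_mult norm_divide norm_inverse divide_inverse)
    also have "\<dots> \<le> U * (V * V)"
      using U V \<open>0 \<le> U\<close> \<open>0 \<le> V\<close> by (intro mult_mono) auto
    finally show ?thesis .
  next
    case False
    then show ?thesis using \<open>0 \<le> U\<close> \<open>0 \<le> V\<close> by (auto simp: qbinom_def)
  qed
  then show thesis by (rule that)
qed

lemma qbinom_tendsto:
  assumes "norm q < 1"
  shows "(\<lambda>M. qbinom q (int M + t) (int b)) \<longlonglongrightarrow> 1 / qpoch q q b"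
proof -
  obtain P where P: "P \<noteq> 0" "(\<lambda>n. qpoch q q n) \<longlonglongrightarrow> P"
    using qpoch_self_converges[OF assms] .
  have at_top: "filterlim (\<lambda>M. nat (int M + s)) at_top sequentially" for s
    by (rule filterlim_at_top_mono[OF filterlim_minus_const_nat_at_top[of "nat (- s)"]])
       (auto intro!: always_eventually)
  have "(\<lambda>M. qpoch q q (nat (int M + t)) / (qpoch q q b * qpoch q q (nat (int M + (t - int b)))))
      \<longlonglongrightarrow> P / (qpoch q q b * P)"
    using P qpoch_self_nonzero[OF assms]
    by (intro tendsto_intros filterlim_compose[OF P(2) at_top]) auto
  also have "P / (qpoch q q b * P) = 1 / qpoch q q b"
    using P(1) by simp
  finally show ?thesis
  proof (rule Lim_transform_eventually)
    show "\<forall>\<^sub>F M in sequentially.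
        qpoch q q (nat (int M + t)) / (qpoch q q b * qpoch q q (nat (int M + (t - int b))))
        = qbinom q (int M + t) (int b)"
      using eventually_ge_at_top[of "nat (int b - t)"]
      by eventually_elim (auto simp: qbinom_def algebra_simps)
  qed
qed

section \<open>The sum in complementary indices\<close>

text \<open>The exponent of \<open>q\<close> in the summand of the limiting series.\<close>

definition limit_exponent :: "int \<Rightarrow> int \<Rightarrow> int" where
  "limit_exponent a b = a\<^sup>2 - 3 * a * b + 3 * b\<^sup>2 - 2 * a + 4 * b + 1"

text \<open>The summand of the normalised \<open>S(0,2;q\<^sup>-\<^sup>1,N)\<close> in the complementary indices, for
  \<open>N + 1 = 2 * c + 3 * d\<close>. It makes sense for all \<open>a\<close> and \<open>b\<close>: the binomials vanish unless
  both \<open>m = 3 * b - 2 * a + c\<close> and \<open>n = d + a - 2 * b\<close> are non-negative. The parameter \<open>d\<close> is an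
  integer because \<open>d = -1\<close> occurs for \<open>N = 0\<close> and \<open>N = 2\<close>.\<close>

definition complementary_term :: "complex \<Rightarrow> int \<Rightarrow> int \<Rightarrow> nat \<times> nat \<Rightarrow> complex" where
  "complementary_term q c d = (\<lambda>(a, b).
     q powi limit_exponent (int a) (int b)
     * qbinom q (3 * int b - int a + c) (int a)
     * qbinom (q ^ 3) (d + int a - int b) (int b))"

lemma summand_complementary:
  assumes q: "q \<noteq> 0"
    and m: "int m = 3 * int b - 2 * int a + c" and n: "int n = d + int a - 2 * int b"
  shows "inverse q ^ (m\<^sup>2 + 3 * m * n + 3 * n\<^sup>2 + 2 * n)
           * qbinom (inverse q) (int m + int a) (int m)
           * qbinom (inverse q ^ 3) (int n + int b) (int n)
           * q powi (c\<^sup>2 + 3 * c * d + 3 * d\<^sup>2 + 2 * d + 1)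
       = complementary_term q c d (a, b)"
proof -
  have q3: "q ^ 3 \<noteq> 0"
    using q by simp
  have ma: "3 * int b - int a + c = int m + int a" and nb: "d + int a - int b = int n + int b"
    using m n by auto
  have c: "c = int m - 3 * int b + 2 * int a" and d: "d = int n - int a + 2 * int b"
    using m n by auto
  define X where "X = m\<^sup>2 + 3 * m * n + 3 * n\<^sup>2 + 2 * n"
  have "c\<^sup>2 + 3 * c * d + 3 * d\<^sup>2 + 2 * d + 1
      = limit_exponent (int a) (int b) + int (X + m * a + 3 * (n * b))"
    unfolding c d X_def limit_exponent_def by (simp add: power2_eq_square algebra_simps)
  then have expo: "q powi (c\<^sup>2 + 3 * c * d + 3 * d\<^sup>2 + 2 * d + 1)
      = q powi limit_exponent (int a) (int b) * (q ^ X * q ^ (m * a) * (q ^ 3) ^ (n * b))"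
    \<comment> \<open>The three powers of \<open>q\<close> cancel those from \<open>S(0,2)\<close> and from inverting the two binomials.\<close>
    using q by (simp only: power_int_add power_int_of_nat power_add power_mult[of q 3]
        not_False_eq_True simp_thms)
  show ?thesis
    unfolding complementary_term_def prod.case ma nb expo X_def[symmetric]
      power_inverse qbinom_inverse[OF q] qbinom_inverse[OF q3]
      qbinom_add_commute[of q m a] qbinom_add_commute[of "q ^ 3" n b]
    using q by simp
qed

lemma S02_inverse_complementary:
  assumes q: "q \<noteq> 0"
    and N: "int N + 1 = 2 * c + 3 * d"
    and L: "\<lfloor>2 / 3 * (real N - 1)\<rfloor> + 1 = c + 2 * d"
  shows "S02 (inverse q) N * q powi (c\<^sup>2 + 3 * c * d + 3 * d\<^sup>2 + 2 * d + 1)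
       = (\<Sum>\<^sub>\<infinity>p\<in>UNIV. complementary_term q c d p)"
proof -
  let ?g = "\<lambda>(m, n). inverse q ^ (m\<^sup>2 + 3 * m * n + 3 * n\<^sup>2 + 2 * n)
        * qbinom (inverse q) (2 * c + 3 * d - int m - 3 * int n) (int m)
        * qbinom (inverse q ^ 3) (c + 2 * d - int m - int n) (int n)
        * q powi (c\<^sup>2 + 3 * c * d + 3 * d\<^sup>2 + 2 * d + 1)"
  \<comment> \<open>The regions outside of which a binomial vanishes; the change of indices is a bijection
    between them.\<close>
  define S where "S = {(m, n). 2 * int m + 3 * int n \<le> 2 * c + 3 * d \<and> int m + 2 * int n \<le> c + 2 * d}"
  define T where "T = {(a, b). 2 * int a \<le> 3 * int b + c \<and> 2 * int b \<le> d + int a}"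
  define \<phi> where "\<phi> = (\<lambda>(m, n). (nat (2 * c + 3 * d - 2 * int m - 3 * int n),
                                    nat (c + 2 * d - int m - 2 * int n)))"
  define \<psi> where "\<psi> = (\<lambda>(a, b). (nat (3 * int b - 2 * int a + c), nat (d + int a - 2 * int b)))"
  have "S02 (inverse q) N * q powi (c\<^sup>2 + 3 * c * d + 3 * d\<^sup>2 + 2 * d + 1) = infsum ?g UNIV"
    unfolding S02_def N L infsum_cmult_left'[symmetric] by (simp add: case_prod_unfold)
  also have "\<dots> = infsum ?g S"
    by (rule infsum_cong_neutral) (auto simp: S_def intro!: qbinom_eq_0 simp del: power_inverse)
  also have "\<dots> = infsum (complementary_term q c d) T"
  proof (rule infsum_reindex_bij_witness[where i = \<psi> and j = \<phi>])
    fix p assume "p \<in> S"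
    then obtain m n where p: "p = (m, n)"
      and le: "2 * int m + 3 * int n \<le> 2 * c + 3 * d" "int m + 2 * int n \<le> c + 2 * d"
      by (auto simp: S_def)
    define a where "a = nat (2 * c + 3 * d - 2 * int m - 3 * int n)"
    define b where "b = nat (c + 2 * d - int m - 2 * int n)"
    have ab: "int a = 2 * c + 3 * d - 2 * int m - 3 * int n" "int b = c + 2 * d - int m - 2 * int n"
      using le by (auto simp: a_def b_def)
    have \<phi>: "\<phi> p = (a, b)"
      by (simp add: \<phi>_def p a_def b_def)
    have mn: "int m = 3 * int b - 2 * int a + c" "int n = d + int a - 2 * int b"
      using ab by auto
    show "\<psi> (\<phi> p) = p"
      unfolding \<phi> unfolding p \<psi>_def prod.case mn[symmetric] by simp
    show "\<phi> p \<in> T"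
      using mn by (simp add: \<phi> T_def)
    have top: "2 * c + 3 * d - int m - 3 * int n = int m + int a"
              "c + 2 * d - int m - int n = int n + int b"
      using ab by auto
    show "complementary_term q c d (\<phi> p) = ?g p"
      unfolding \<phi> unfolding p prod.case top using summand_complementary[OF q mn] by simp
  next
    fix p assume "p \<in> T"
    then obtain a b where p: "p = (a, b)"
      and le: "2 * int a \<le> 3 * int b + c" "2 * int b \<le> d + int a"
      by (auto simp: T_def)
    have mn: "int (fst (\<psi> p)) = 3 * int b - 2 * int a + c" "int (snd (\<psi> p)) = d + int a - 2 * int b"
      using le by (auto simp: \<psi>_def p)
    show "\<phi> (\<psi> p) = p"
      unfolding \<phi>_def case_prod_unfold mn by (simp add: p)
    show "\<psi> p \<in> S"
      unfolding S_def case_prod_unfold mem_Collect_eq mn by simp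
  qed
  also have "\<dots> = infsum (complementary_term q c d) UNIV"
    by (rule infsum_cong_neutral) (auto simp: T_def complementary_term_def intro!: qbinom_eq_0)
  finally show ?thesis .
qed

section \<open>Passage to the limit\<close>

lemma limit_exponent_ge: "a + b - 2 \<le> limit_exponent a b"
proof -
  \<comment> \<open>The difference of the two sides has its minimum over the reals at \<open>a = 3\<close>, \<open>b = 1\<close>, with
    value 0; complete the squares there.\<close>
  have "0 \<le> (2 * (a - 3) - 3 * (b - 1))\<^sup>2 + 3 * (b - 1)\<^sup>2"
    by simp
  also have "\<dots> = 4 * (limit_exponent a b - (a + b - 2))"
    by (simp add: limit_exponent_def power2_eq_square algebra_simps)
  finally show ?thesis by simp
qed

text \<open>The bound \<open>w\<close> does not depend on \<open>d\<close>, as dominated convergence requires.\<close>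

lemma complementary_term_dominated:
  assumes "0 < norm q" and "norm q < 1"
  obtains w :: "nat \<times> nat \<Rightarrow> real" where "w summable_on UNIV"
    and "\<And>d p. norm (complementary_term q c d p) \<le> w p"
proof -
  define r where "r = norm q"
  have r: "0 < r" "r < 1" using assms by (auto simp: r_def)
  have q3: "norm (q ^ 3) < 1"
    using assms by (simp add: norm_power power_less_one_iff)
  obtain B where B: "\<And>k l. norm (qbinom q k l) \<le> B"
    using qbinom_bounded[OF assms(2)] by blast
  obtain B' where B': "\<And>k l. norm (qbinom (q ^ 3) k l) \<le> B'"
    using qbinom_bounded[OF q3] by blast
  have pos: "0 \<le> B" "0 \<le> B'"
    using B B' norm_ge_zero order_trans by blast+
  define w where "w = (\<lambda>(a, b). r ^ a * r ^ b * (B * B' / r\<^sup>2))"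
  show thesis
  proof (rule that[of w])
    have "(\<lambda>n. r ^ n) summable_on UNIV"
      using r by (intro norm_summable_imp_summable_on) (simp add: summable_geometric)
    then have "(\<lambda>(a, b). r ^ a * r ^ b) summable_on UNIV \<times> UNIV"
      using r by (intro summable_on_SigmaI[where g = "\<lambda>a. r ^ a * (\<Sum>\<^sub>\<infinity>b. r ^ b)"])
        (auto intro!: has_sum_cmult_right summable_on_cmult_left)
    then have "(\<lambda>p. (\<lambda>(a, b). r ^ a * r ^ b) p * (B * B' / r\<^sup>2)) summable_on UNIV"
      by (intro summable_on_cmult_left) simp
    then show "w summable_on UNIV"
      by (simp add: w_def case_prod_unfold)
  next
    fix d and p :: "nat \<times> nat"
    obtain a b where p: "p = (a, b)" by force
    have "norm (q powi limit_exponent (int a) (int b)) = r powi limit_exponent (int a) (int b)"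
      by (simp add: norm_power_int r_def)
    also have "\<dots> \<le> r powi (int a + int b - 2)"
      using r limit_exponent_ge by (intro power_int_decreasing) auto
    also have "\<dots> = r ^ a * r ^ b / r\<^sup>2"
      using r by (simp add: power_int_diff power_int_add)
    finally have "norm (complementary_term q c d p) \<le> r ^ a * r ^ b / r\<^sup>2 * B * B'"
      unfolding complementary_term_def p prod.case norm_mult
      using r pos B B' by (intro mult_mono) auto
    then show "norm (complementary_term q c d p) \<le> w p"
      by (simp add: w_def p)
  qed
qed

lemma complementary_term_tendsto:
  assumes "norm q < 1"
  shows "(\<lambda>M. complementary_term q c (int M + k) p) \<longlonglongrightarrow> limit_term q c p"
proof -
  obtain a b where p: "p = (a, b)" by force
  have "norm (q ^ 3) < 1"
    using assms by (simp add: norm_power power_less_one_iff)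
  from qbinom_tendsto[OF this, of "k + int a - int b" b]
  have "(\<lambda>M. qbinom (q ^ 3) (int M + k + int a - int b) (int b)) \<longlonglongrightarrow> 1 / qpoch (q ^ 3) (q ^ 3) b"
    by (simp add: algebra_simps)
  from tendsto_mult_left[OF this, of "q powi limit_exponent (int a) (int b)
      * qbinom q (3 * int b - int a + c) (int a)"]
  show ?thesis
    by (simp add: complementary_term_def limit_term_def limit_exponent_def p)
qed

text \<open>Dominated convergence for the counting measure on pairs of natural numbers.\<close>

lemma complementary_sum_tendsto:
  assumes "0 < norm q" and "norm q < 1"
  shows "limit_term q c summable_on UNIV"
    and "(\<lambda>M. \<Sum>\<^sub>\<infinity>p\<in>UNIV. complementary_term q c (int M + k) p)
           \<longlonglongrightarrow> (\<Sum>\<^sub>\<infinity>p\<in>UNIV. limit_term q c p)"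
proof -
  obtain w where w: "w summable_on UNIV" "\<And>d p. norm (complementary_term q c d p) \<le> w p"
    using complementary_term_dominated[OF assms, of c] by blast
  have int_w: "integrable (count_space UNIV) w"
    using iffD1[OF abs_summable_equivalent iffD1[OF summable_on_iff_abs_summable_on_real w(1)]]
    by (simp only: abs_summable_on_def)
  note dct = int_w complementary_term_tendsto[OF assms(2)] w(2)
  have int_lim: "integrable (count_space UNIV) (limit_term q c)"
    by (rule integrable_dominated_convergence[where w = w
          and s = "\<lambda>M. complementary_term q c (int M + k)"]) (use dct in auto)
  have int_term: "integrable (count_space UNIV) (complementary_term q c (int M + k))" for M
    by (rule integrable_dominated_convergence2[where w = w and f = "limit_term q c"
          and s = "\<lambda>M. complementary_term q c (int M + k)"]) (use dct in auto)
  have infsum: "integral\<^sup>L (count_space UNIV) f = infsum f UNIV"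
    if "integrable (count_space UNIV) f" for f :: "nat \<times> nat \<Rightarrow> complex"
    using infsetsum_infsum[of f UNIV] that by (simp add: abs_summable_on_def infsetsum_def)
  show "limit_term q c summable_on UNIV"
    using int_lim unfolding abs_summable_on_def[symmetric]
    by (rule iffD2[OF summable_on_iff_abs_summable_on_complex iffD2[OF abs_summable_equivalent]])
  have "(\<lambda>M. integral\<^sup>L (count_space UNIV) (complementary_term q c (int M + k)))
      \<longlonglongrightarrow> integral\<^sup>L (count_space UNIV) (limit_term q c)"
    by (rule integral_dominated_convergence[where w = w]) (use dct in auto)
  then show "(\<lambda>M. \<Sum>\<^sub>\<infinity>p\<in>UNIV. complementary_term q c (int M + k) p)
      \<longlonglongrightarrow> (\<Sum>\<^sub>\<infinity>p\<in>UNIV. limit_term q c p)"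
    by (simp add: infsum[OF int_lim] infsum[OF int_term])
qed

lemma S02_inverse_tendsto:
  assumes "0 < norm q" and "norm q < 1"
    and N: "\<And>M. int (N M) + 1 = 2 * c + 3 * (int M + k)"
    and L: "\<And>M. \<lfloor>2 / 3 * (real (N M) - 1)\<rfloor> + 1 = c + 2 * (int M + k)"
    and e: "\<And>M. int (e M) = c\<^sup>2 + 3 * c * (int M + k) + 3 * (int M + k)\<^sup>2 + 2 * (int M + k) + 1"
  shows "limit_term q c summable_on UNIV \<and>
    (\<lambda>M. S02 (inverse q) (N M) * q ^ e M) \<longlonglongrightarrow> (\<Sum>\<^sub>\<infinity>p\<in>UNIV. limit_term q c p)"
proof -
  have powi: "q ^ e M = q powi (c\<^sup>2 + 3 * c * (int M + k) + 3 * (int M + k)\<^sup>2 + 2 * (int M + k) + 1)"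
    for M
    by (simp only: e[symmetric] power_int_of_nat)
  have "S02 (inverse q) (N M) * q ^ e M = (\<Sum>\<^sub>\<infinity>p\<in>UNIV. complementary_term q c (int M + k) p)" for M
    unfolding powi by (rule S02_inverse_complementary[OF _ N L]) (use assms(1) in auto)
  with complementary_sum_tendsto[OF assms(1,2)] show ?thesis by simp
qed

theorem theorem5p4:
  fixes q :: complex
  assumes "0 < norm q" and "norm q < 1"
  shows "(limit_term q 1 summable_on UNIV \<and>
          (\<lambda>M. S02 (inverse q) (3 * M + 1) * q ^ ((M + 1) * (3 * M + 2)))
            \<longlonglongrightarrow> (\<Sum>\<^sub>\<infinity>p\<in>UNIV. limit_term q 1 p)) \<and>
         (limit_term q 2 summable_on UNIV \<and>
          (\<lambda>M. S02 (inverse q) (3 * M) * q ^ (M * (3 * M + 2)))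
            \<longlonglongrightarrow> (\<Sum>\<^sub>\<infinity>p\<in>UNIV. limit_term q 2 p)) \<and>
         (limit_term q 3 summable_on UNIV \<and>
          (\<lambda>M. S02 (inverse q) (3 * M + 2) * q ^ ((M + 1) * (3 * M + 2)))
            \<longlonglongrightarrow> (\<Sum>\<^sub>\<infinity>p\<in>UNIV. limit_term q 3 p))"
proof (intro conjI[OF _ conjI])
  show "limit_term q 1 summable_on UNIV \<and>
      (\<lambda>M. S02 (inverse q) (3 * M + 1) * q ^ ((M + 1) * (3 * M + 2)))
        \<longlonglongrightarrow> (\<Sum>\<^sub>\<infinity>p\<in>UNIV. limit_term q 1 p)"
  proof (rule S02_inverse_tendsto[OF assms, where k = 0])
    fix M :: nat
    have "\<lfloor>2 / 3 * (real (3 * M + 1) - 1)\<rfloor> = 2 * int M"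
      by (rule floor_unique) auto
    then show "\<lfloor>2 / 3 * (real (3 * M + 1) - 1)\<rfloor> + 1 = 1 + 2 * (int M + 0)" by simp
  qed (auto simp: power2_eq_square algebra_simps)
  show "limit_term q 2 summable_on UNIV \<and>
      (\<lambda>M. S02 (inverse q) (3 * M) * q ^ (M * (3 * M + 2)))
        \<longlonglongrightarrow> (\<Sum>\<^sub>\<infinity>p\<in>UNIV. limit_term q 2 p)"
  proof (rule S02_inverse_tendsto[OF assms, where k = "- 1"])
    fix M :: nat
    have "\<lfloor>2 / 3 * (real (3 * M) - 1)\<rfloor> = 2 * int M - 1"
      by (rule floor_unique) auto
    then show "\<lfloor>2 / 3 * (real (3 * M) - 1)\<rfloor> + 1 = 2 + 2 * (int M + - 1)" by simp
  qed (auto simp: power2_eq_square algebra_simps)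
  show "limit_term q 3 summable_on UNIV \<and>
      (\<lambda>M. S02 (inverse q) (3 * M + 2) * q ^ ((M + 1) * (3 * M + 2)))
        \<longlonglongrightarrow> (\<Sum>\<^sub>\<infinity>p\<in>UNIV. limit_term q 3 p)"
  proof (rule S02_inverse_tendsto[OF assms, where k = "- 1"])
    fix M :: nat
    have "\<lfloor>2 / 3 * (real (3 * M + 2) - 1)\<rfloor> = 2 * int M"
      by (rule floor_unique) auto
    then show "\<lfloor>2 / 3 * (real (3 * M + 2) - 1)\<rfloor> + 1 = 3 + 2 * (int M + - 1)" by simp
  qed (auto simp: power2_eq_square algebra_simps)
qed

end
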